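(* Let $n\ge 1$ and let $A$ be an $n\times n$ matrix with rational entries. There exists a finite set $\mathcal{D}\subset \mathbb{Z}^n[A]$ such that $(A,\mathcal{D})$ is a digit system in $\mathbb{Z}^n[A]$ with the finiteness property if and only if $A$ has no (complex) eigenvalue $\lambda$ with $|\lambda|<1$. Moreover, when this condition holds, the digit set $\mathcal{D}$ can be chosen to be a subset of $\mathbb{Z}^n$.
   Context: For $A\in M_n(\mathbb{Q})$, define the $\mathbb{Z}$-module $\mathbb{Z}^n[A]:=\bigcup_{k=1}^{\infty}\left(\mathbb{Z}^n + A\mathbb{Z}^n+\dots+A^{k-1}\mathbb{Z}^n\right)$, the smallest $A$-invariant $\mathbb{Z}$-module containing $\mathbb{Z}^n$. For a finite set $\mathcal{D}\subset\mathbb{Z}^n[A]$, the pair $(A,\mathcal{D})$ is called a digit system in $\mathbb{Z}^n[A]$, and $\mathcal{D}[A]:=\{\mathbf{d}_0+A\mathbf{d}_1+\dots+A^k\mathbf{d}_k : k\ge 0,\ \mathbf{d}_j\in\mathcal{D}\}$. The digit system has the finiteness property if $\mathcal{D}[A]=\mathbb{Z}^n[A]$, i.e., every $\mathbf{z}\in\mathbb{Z}^n[A]$ can be written as $\mathbf{z}=\mathbf{d}_0+A\mathbf{d}_1+\dots+A^k\mathbf{d}_k$ for some $k\in\mathbb{N}$ and $\mathbf{d}_j\in\mathcal{D}$. *)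

theory Defs
  imports Complex_Main "Jordan_Normal_Form.Char_Poly"
begin

definition int_vecs :: "nat \<Rightarrow> rat vec set" where
  "int_vecs n = {v \<in> carrier_vec n. \<forall>i<n. v $ i \<in> \<int>}"

definition matrix_power_sum :: "nat \<Rightarrow> rat mat \<Rightarrow> (nat \<Rightarrow> rat vec) \<Rightarrow> nat set \<Rightarrow> rat vec" where
  "matrix_power_sum n A v J = finsum_vec TYPE(rat) n (\<lambda>j. (A ^\<^sub>m j) *\<^sub>v v j) J"

definition int_module :: "nat \<Rightarrow> rat mat \<Rightarrow> rat vec set" where
  "int_module n A =
     (\<Union>k\<in>{1..}. {matrix_power_sum n A v {..<k} | v. \<forall>j<k. v j \<in> int_vecs n})"

definition digit_system :: "nat \<Rightarrow> rat mat \<Rightarrow> rat vec set \<Rightarrow> bool" where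
  "digit_system n A D \<longleftrightarrow> finite D \<and> D \<subseteq> int_module n A"

definition digit_expansions :: "nat \<Rightarrow> rat mat \<Rightarrow> rat vec set \<Rightarrow> rat vec set" where
  "digit_expansions n A D = {matrix_power_sum n A d {..k} | k d. \<forall>j\<le>k. d j \<in> D}"

definition finiteness_property :: "nat \<Rightarrow> rat mat \<Rightarrow> rat vec set \<Rightarrow> bool" where
  "finiteness_property n A D \<longleftrightarrow> digit_expansions n A D = int_module n A"

end

theory Submission
  imports Defs "HOL-Computational_Algebra.Field_as_Ring"
begin

text \<open>
  Since \<open>A\<close> is annihilated by its characteristic polynomial, it suffices to find an integer
  multiple \<open>f\<close> of that polynomial such that every integer polynomial is congruent modulo \<open>f\<close>
  to one with coefficients bounded by a constant \<open>B\<close>; applied to the coordinates of the vectors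
  in a representation of an element of the module, this yields digits in the box \<open>[-B, B]\<^sup>n\<close>.
  The property is inherited by products, so \<open>f\<close> may be assumed to be irreducible over the
  rationals, and then it has \<open>m = deg f\<close> distinct complex roots, all of modulus at least 1.
  For a polynomial \<open>p\<close> of degree less than \<open>m\<close> one splits off a block of \<open>m\<close> digits,
  \<open>p = d + x\<^sup>m q\<close> modulo \<open>f\<close>. By Lagrange interpolation at the roots, \<open>d\<close> can be chosen so that
  \<open>d(a)\<close> is, for all roots \<open>a\<close> at once and up to a bounded error \<open>E\<close>, the number of modulus
  \<open>K = E + 1\<close> with the argument of \<open>p(a)\<close>. Then \<open>|q(a)| \<le> |p(a) - d(a)|\<close> is smaller than
  \<open>|p(a)|\<close> by at least 1 unless it is already bounded by \<open>2E + 1\<close>, and the procedure ends with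
  a polynomial whose values at all roots, hence whose coefficients, are bounded.
\<close>

section \<open>Height reduction modulo an integer polynomial\<close>

text \<open>Only the height of \<open>h\<close> is bounded, not its degree: digits must stay bounded
  while the length of an expansion may grow.\<close>

definition reduces_to_height :: "int \<Rightarrow> int poly \<Rightarrow> int poly \<Rightarrow> bool" where
  "reduces_to_height B f p \<longleftrightarrow> (\<exists>h. f dvd p - h \<and> (\<forall>j. \<bar>coeff h j\<bar> \<le> B))"

definition height_reducing :: "int poly \<Rightarrow> bool" where
  "height_reducing f \<longleftrightarrow> (\<exists>B. \<forall>p. reduces_to_height B f p)"

lemma coeff_sum_monom: "coeff (\<Sum>j<n. monom (w j) j) i = (if i < n then w i else 0)"
  by (simp add: coeff_sum)

lemma poly_eq_sum_lessThan:
  fixes p :: "'a::comm_semiring_1 poly"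
  assumes "\<And>j. j \<ge> n \<Longrightarrow> coeff p j = 0"
  shows "poly p x = (\<Sum>j<n. coeff p j * x ^ j)"
proof -
  have "p = (\<Sum>j<n. monom (coeff p j) j)"
    by (rule poly_eqI) (use assms in \<open>auto simp: coeff_sum_monom not_less\<close>)
  then have "poly p x = poly (\<Sum>j<n. monom (coeff p j) j) x" by simp
  then show ?thesis by (simp add: poly_sum poly_monom)
qed

text \<open>At most \<open>degree q + 1\<close> terms of each convolution sum are nonzero, so the
  bound is independent of the degree of \<open>p\<close>.\<close>

lemma abs_coeff_mult_le:
  fixes p q :: "int poly"
  assumes "\<And>j. \<bar>coeff p j\<bar> \<le> B" "B \<ge> 0"
  shows "\<bar>coeff (p * q) j\<bar> \<le> B * (\<Sum>i\<le>degree q. \<bar>coeff q i\<bar>)"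
proof -
  have "\<bar>coeff (q * p) j\<bar> \<le> (\<Sum>i\<le>j. \<bar>coeff q i * coeff p (j - i)\<bar>)"
    unfolding coeff_mult by (rule sum_abs)
  also have "\<dots> \<le> (\<Sum>i\<le>j. \<bar>coeff q i\<bar> * B)"
    by (intro sum_mono) (simp add: abs_mult assms mult_left_mono)
  also have "\<dots> \<le> (\<Sum>i\<le>max j (degree q). \<bar>coeff q i\<bar> * B)"
    by (intro sum_mono2) (auto simp: assms)
  also have "\<dots> = (\<Sum>i\<le>degree q. \<bar>coeff q i\<bar> * B)"
    by (intro sum.mono_neutral_right) (auto simp: coeff_eq_0)
  finally show ?thesis by (simp add: sum_distrib_left mult.commute)
qed

text \<open>If \<open>p = q f + r\<close> and \<open>q = s g + t\<close> with \<open>r\<close> and \<open>t\<close> of bounded height, then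
  \<open>t f + r\<close> has bounded height and \<open>p = s f g + (t f + r)\<close>.\<close>

lemma height_reducing_mult:
  assumes "height_reducing f" "height_reducing g"
  shows "height_reducing (f * g)"
proof -
  obtain B where B: "\<And>p. reduces_to_height B f p"
    using assms(1) by (auto simp: height_reducing_def)
  obtain C where C: "\<And>p. reduces_to_height C g p"
    using assms(2) by (auto simp: height_reducing_def)
  let ?s = "\<Sum>i\<le>degree f. \<bar>coeff f i\<bar>"
  have "reduces_to_height (B + C * ?s) (f * g) p" for p
  proof -
    obtain r q where r: "p - r = f * q" "\<And>j. \<bar>coeff r j\<bar> \<le> B"
      using B[of p] by (auto simp: reduces_to_height_def dvd_def)
    obtain t s where t: "q - t = g * s" "\<And>j. \<bar>coeff t j\<bar> \<le> C"
      using C[of q] by (auto simp: reduces_to_height_def dvd_def)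
    have "C \<ge> 0" using t(2)[of 0] by linarith
    have "p - (r + t * f) = f * (q - t)" using r(1) by (simp add: algebra_simps)
    then have "p - (r + t * f) = (f * g) * s" using t(1) by (simp add: mult.assoc)
    moreover have "\<bar>coeff (r + t * f) j\<bar> \<le> B + C * ?s" for j
      using r(2)[of j] abs_coeff_mult_le[OF t(2) \<open>C \<ge> 0\<close>, of f j] by simp
    ultimately show ?thesis unfolding reduces_to_height_def by (metis dvd_triv_left)
  qed
  then show ?thesis by (auto simp: height_reducing_def)
qed

text \<open>Base case of the later induction on factorisations: coefficientwise residues modulo
  \<open>c\<close> are bounded.\<close>

lemma height_reducing_const:
  assumes "c \<noteq> 0"
  shows "height_reducing [:c:]"
proof -
  have "reduces_to_height \<bar>c\<bar> [:c:] p" for p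
  proof -
    let ?h = "map_poly (\<lambda>x. x mod c) p"
    have "[:c:] dvd p - ?h"
      by (auto simp: const_poly_dvd_iff coeff_map_poly)
    moreover have "\<bar>coeff ?h j\<bar> \<le> \<bar>c\<bar>" for j
      using abs_mod_less[OF assms, of "coeff p j"] by (simp add: coeff_map_poly)
    ultimately show ?thesis by (auto simp: reduces_to_height_def)
  qed
  then show ?thesis by (auto simp: height_reducing_def)
qed

text \<open>The block \<open>d\<close> lives below position \<open>k\<close> and the shifted
  representative of \<open>q\<close> from \<open>k\<close> on. The two never overlap, so the same
  \<open>B\<close> survives any number of iterations.\<close>

lemma reduces_to_height_shift:
  assumes dvd: "f dvd p - d - monom 1 k * q"
    and d: "\<And>j. j \<ge> k \<Longrightarrow> coeff d j = 0" "\<And>j. \<bar>coeff d j\<bar> \<le> B"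
    and q: "reduces_to_height B f q"
  shows "reduces_to_height B f p"
proof -
  obtain h where h: "f dvd q - h" "\<And>j. \<bar>coeff h j\<bar> \<le> B"
    using q by (auto simp: reduces_to_height_def)
  have "f dvd (p - d - monom 1 k * q) + monom 1 k * (q - h)"
    using dvd h(1) by simp
  then have "f dvd p - (d + monom 1 k * h)" by (simp add: algebra_simps)
  moreover have "\<bar>coeff (d + monom 1 k * h) j\<bar> \<le> B" for j
    using d(1)[of j] d(2)[of j] h(2)[of "j - k"] by (auto simp: coeff_monom_mult)
  ultimately show ?thesis by (auto simp: reduces_to_height_def)
qed

text \<open>Division from the low end: each step clears the constant coefficient modulo
  the constant coefficient of \<open>f\<close> and divides by the variable.\<close>

lemma low_end_division:
  fixes f p :: "int poly"
  assumes f0: "coeff f 0 \<noteq> 0"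
  shows "\<exists>d q. f dvd p - d - monom 1 k * q \<and> (\<forall>j\<ge>k. coeff d j = 0) \<and>
           (\<forall>j. \<bar>coeff d j\<bar> \<le> \<bar>coeff f 0\<bar>) \<and> degree q \<le> max (degree p - k) (degree f - 1)"
proof (induction k)
  case 0
  show ?case by (rule exI[of _ 0], rule exI[of _ p]) simp
next
  case (Suc k)
  then obtain d q where dq: "f dvd p - d - monom 1 k * q" "\<forall>j\<ge>k. coeff d j = 0"
    "\<forall>j. \<bar>coeff d j\<bar> \<le> \<bar>coeff f 0\<bar>" "degree q \<le> max (degree p - k) (degree f - 1)"
    by auto
  define c where "c = coeff q 0 mod coeff f 0"
  define r where "r = q - [:c:] - Polynomial.smult (coeff q 0 div coeff f 0) f"
  have "coeff r 0 = 0"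
    by (simp add: r_def c_def minus_mod_eq_div_mult)
  then obtain s where s: "r = pCons 0 s" by (cases r) auto
  \<comment> \<open>Subtracting a multiple of \<open>f\<close> can raise the degree to that of
    \<open>f\<close>, and the division by the variable then lowers it by one; hence the bound
    settles at \<open>degree f - 1\<close>.\<close>
  have "degree r \<le> max (degree q) (degree f)"
    unfolding r_def by (intro degree_diff_le) (auto intro: order.trans[OF degree_smult_le])
  then have deg: "degree s \<le> max (degree q) (degree f) - 1"
    by (cases "s = 0") (auto simp: s)
  have "monom 1 (Suc k) * s = monom 1 k * r"
    by (simp add: s monom_Suc)
  then have "p - (d + monom c k) - monom 1 (Suc k) * s =
      (p - d - monom 1 k * q) + Polynomial.smult (coeff q 0 div coeff f 0) (f * monom 1 k)"
    by (simp add: r_def algebra_simps smult_monom)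
  then have "f dvd p - (d + monom c k) - monom 1 (Suc k) * s"
    using dq(1) by (metis dvd_add dvd_smult dvd_triv_left)
  moreover have "\<forall>j\<ge>Suc k. coeff (d + monom c k) j = 0" using dq(2) by auto
  moreover have "\<forall>j. \<bar>coeff (d + monom c k) j\<bar> \<le> \<bar>coeff f 0\<bar>"
    using dq(2,3) abs_mod_less[OF f0, of "coeff q 0"] by (auto simp: c_def)
  moreover have "degree s \<le> max (degree p - Suc k) (degree f - 1)"
    using deg dq(4) by linarith
  ultimately show ?case by blast
qed

section \<open>Squarefree polynomials: interpolation at the roots\<close>

lemma lagrange_basis_exists:
  fixes R :: "'a::field set"
  assumes "finite R"
  shows "\<exists>L. \<forall>a\<in>R. degree (L a) < card R \<and> (\<forall>b\<in>R. poly (L a) b = (if a = b then 1 else 0))"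
proof -
  define L where "L a = Polynomial.smult (inverse (\<Prod>b\<in>R - {a}. a - b)) (\<Prod>b\<in>R - {a}. [:-b, 1:])" for a
  have "degree (L a) < card R" if "a \<in> R" for a
  proof -
    have "degree (L a) \<le> degree (\<Prod>b\<in>R - {a}. [:-b, 1:])"
      unfolding L_def by (rule degree_smult_le)
    also have "\<dots> \<le> (\<Sum>b\<in>R - {a}. degree [:-b, 1:])"
      using degree_prod_sum_le[of "R - {a}" "\<lambda>b. [:-b, 1:]"] assms by (simp add: o_def)
    also have "\<dots> = card (R - {a})" by simp
    also have "\<dots> < card R" using assms that by (rule card_Diff1_less)
    finally show ?thesis .
  qed
  moreover have "poly (L a) b = (if a = b then 1 else 0)" if "a \<in> R" "b \<in> R" for a b
    using assms that by (auto simp: L_def poly_prod prod_zero_iff)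
  ultimately show ?thesis by blast
qed

text \<open>Subtracting length \<open>K\<close> along the direction of \<open>p\<close> leaves
  modulus at most the distance from \<open>cmod p\<close> to \<open>K\<close>. If
  \<open>cmod p\<close> is at least \<open>K = E + 1\<close>, the gain pays for the error
  \<open>E\<close> and 1 remains; otherwise at most \<open>K\<close> is left, and
  \<open>K + E = 2 * E + 1\<close>.\<close>

lemma norm_diff_scaled_sgn_le:
  fixes p :: complex and K E :: real
  assumes "K = E + 1" "E \<ge> 0"
  shows "cmod (p - of_real K * sgn p) + E \<le> max (2 * E + 1) (cmod p - 1)"
proof -
  have "p = of_real (cmod p) * sgn p" by (simp add: sgn_eq)
  then have "p - of_real K * sgn p = of_real (cmod p - K) * sgn p"
    by (metis of_real_diff left_diff_distrib)
  then have "cmod (p - of_real K * sgn p) = \<bar>cmod p - K\<bar> * cmod (sgn p)"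
    by (simp only: norm_mult norm_of_real)
  also have "\<dots> \<le> \<bar>cmod p - K\<bar> * 1"
    by (intro mult_left_mono) (auto simp: norm_sgn)
  finally have le: "cmod (p - of_real K * sgn p) \<le> \<bar>cmod p - K\<bar>" by simp
  show ?thesis
  proof (cases "cmod p \<ge> K")
    case True
    then have "cmod (p - of_real K * sgn p) + E \<le> cmod p - 1" using le assms by linarith
    then show ?thesis by simp
  next
    case False
    then have "cmod (p - of_real K * sgn p) + E \<le> 2 * E + 1"
      using le assms norm_ge_zero[of p] by linarith
    then show ?thesis by simp
  qed
qed

lemma poly_of_int_poly_cnj:
  "poly (of_int_poly p :: complex poly) (cnj x) = cnj (poly (of_int_poly p) x)"
  by (simp add: poly_cnj_real)

lemma height_reducing_squarefree:
  fixes f :: "int poly"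
  assumes deg: "degree f > 0"
    and sf: "rsquarefree (of_int_poly f :: complex poly)"
    and roots: "\<And>z. poly (of_int_poly f :: complex poly) z = 0 \<Longrightarrow> cmod z \<ge> 1"
  shows "height_reducing f"
proof -
  let ?F = "of_int_poly f :: complex poly"
  let ?ev = "\<lambda>p :: int poly. poly (of_int_poly p :: complex poly)"
  define n where "n = degree f"
  define R where "R = {z. poly ?F z = 0}"
  have F0: "?F \<noteq> 0" using deg by auto
  have fin: "finite R" unfolding R_def using F0 by (rule poly_roots_finite)
  have cardR: "card R = n"
    using rsquarefree_card_degree[OF F0] sf by (simp add: R_def n_def)
  have f0: "coeff f 0 \<noteq> 0"
  proof
    assume "coeff f 0 = 0"
    then have "poly ?F 0 = 0" by (simp add: poly_0_coeff_0)
    from roots[OF this] show False by simp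
  qed
  \<comment> \<open>Closure of the roots under conjugation will allow interpolation with real
    coefficients.\<close>
  have cnjR: "cnj a \<in> R" if "a \<in> R" for a
    using that by (simp add: R_def poly_of_int_poly_cnj)
  obtain L where L: "\<And>a. a \<in> R \<Longrightarrow> degree (L a) < n"
    "\<And>a b. a \<in> R \<Longrightarrow> b \<in> R \<Longrightarrow> poly (L a) b = (if a = b then 1 else 0)"
    using lagrange_basis_exists[OF fin] cardR by metis
  define ip where "ip t = (\<Sum>a\<in>R. Polynomial.smult (t a) (L a))" for t
  have ip_coeff0: "coeff (ip t) j = 0" if "j \<ge> n" for t j
    using L(1) that by (fastforce simp: ip_def coeff_sum coeff_eq_0 intro!: sum.neutral)
  have ip_poly: "poly (ip t) b = t b" if "b \<in> R" for t b
  proof -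
    have "poly (ip t) b = (\<Sum>a\<in>R. if b = a then t a else 0)"
      unfolding ip_def poly_sum by (intro sum.cong) (auto simp: L(2) that)
    then show ?thesis using fin that by simp
  qed
  \<comment> \<open>\<open>C\<close> converts a bound \<open>M\<close> on prescribed values at the
    roots into a bound \<open>M * C\<close> on all coefficients of the interpolant.\<close>
  define C where "C = (\<Sum>j<n. \<Sum>a\<in>R. cmod (coeff (L a) j))"
  have C0: "C \<ge> 0" unfolding C_def by (intro sum_nonneg) auto
  have ip_bound: "cmod (coeff (ip t) j) \<le> M * C" if "\<And>a. a \<in> R \<Longrightarrow> cmod (t a) \<le> M" "M \<ge> 0" for t M j
  proof (cases "j < n")
    case True
    have "cmod (coeff (ip t) j) \<le> (\<Sum>a\<in>R. cmod (t a) * cmod (coeff (L a) j))"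
      unfolding ip_def coeff_sum by (rule order.trans[OF norm_sum]) (simp add: norm_mult)
    also have "\<dots> \<le> (\<Sum>a\<in>R. M * cmod (coeff (L a) j))"
      by (intro sum_mono mult_right_mono that) auto
    also have "\<dots> = M * (\<Sum>a\<in>R. cmod (coeff (L a) j))" by (simp add: sum_distrib_left)
    also have "\<dots> \<le> M * C"
      unfolding C_def using True
      by (intro mult_left_mono that member_le_sum) (auto intro: sum_nonneg)
    finally show ?thesis .
  next
    case False
    then show ?thesis using ip_coeff0[of j t] that(2) C0 by simp
  qed
  have ip_unique: "p = ip (poly p)" if "degree p < n" for p
  proof (rule ccontr)
    let ?d = "p - ip (poly p)"
    assume "p \<noteq> ip (poly p)"
    then have d0: "?d \<noteq> 0" by simp
    have "coeff ?d j = 0" if "j \<ge> n" for j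
      using \<open>degree p < n\<close> that by (simp add: ip_coeff0 coeff_eq_0)
    then have "degree ?d < n"
      using d0 by (metis leading_coeff_0_iff not_less)
    moreover have "R \<subseteq> {z. poly ?d z = 0}" by (auto simp: ip_poly)
    then have "n \<le> degree ?d"
      using card_mono[OF poly_roots_finite[OF d0]] card_poly_roots_bound[OF d0] cardR
      by (meson order.trans)
    ultimately show False by simp
  qed
  \<comment> \<open>\<open>S\<close> serves the converse estimate: coefficients bounded by
    \<open>M\<close> give values bounded by \<open>M * S\<close> at every root.\<close>
  define S where "S = (\<Sum>a\<in>R. \<Sum>j<n. cmod a ^ j)"
  have eval_bound: "cmod (\<Sum>j<n. c j * a ^ j) \<le> M * S"
    if "a \<in> R" "\<And>j. j < n \<Longrightarrow> cmod (c j) \<le> M" "M \<ge> 0" for a c M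
  proof -
    have "cmod (\<Sum>j<n. c j * a ^ j) \<le> (\<Sum>j<n. cmod (c j) * cmod a ^ j)"
      by (rule order.trans[OF norm_sum]) (simp add: norm_mult norm_power)
    also have "\<dots> \<le> (\<Sum>j<n. M * cmod a ^ j)"
      by (intro sum_mono mult_right_mono that) auto
    also have "\<dots> = M * (\<Sum>j<n. cmod a ^ j)" by (simp add: sum_distrib_left)
    also have "\<dots> \<le> M * S"
      unfolding S_def using that fin
      by (intro mult_left_mono member_le_sum[of a R "\<lambda>a. \<Sum>j<n. cmod a ^ j"])
         (auto intro: sum_nonneg)
    finally show ?thesis .
  qed
  have S0: "S \<ge> 0" unfolding S_def by (intro sum_nonneg) auto
  \<comment> \<open>Total error at a root: rounding the coefficients costs at most \<open>S\<close>,
    and the low-end digits, of height at most that of \<open>coeff f 0\<close>, cost the other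
    summand.\<close>
  define E where "E = (1 + \<bar>real_of_int (coeff f 0)\<bar>) * S"
  define K where "K = E + 1"
  have E0: "E \<ge> 0" using S0 by (simp add: E_def)
  \<comment> \<open>The first ceiling covers the terminal polynomial, whose values are at most
    \<open>2 * E + 1\<close>; the second, with the 1, covers a rounded interpolant of values of
    modulus at most \<open>K\<close>; the last term covers the low-end digits.\<close>
  define B where "B = \<lceil>(2 * E + 1) * C\<rceil> + \<lceil>K * C\<rceil> + 1 + \<bar>coeff f 0\<bar>"
  have "0 \<le> K * C" "0 \<le> (2 * E + 1) * C" using E0 C0 by (simp_all add: K_def)
  then have ceil0: "0 \<le> \<lceil>K * C\<rceil>" "0 \<le> \<lceil>(2 * E + 1) * C\<rceil>" by linarith+

  have step: "\<exists>d q. f dvd p - d - monom 1 n * q \<and> (\<forall>j\<ge>n. coeff d j = 0) \<and>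
      (\<forall>j. \<bar>coeff d j\<bar> \<le> B) \<and> degree q < n \<and>
      (\<forall>a\<in>R. cmod (?ev q a) \<le> max (2 * E + 1) (cmod (?ev p a) - 1))"
    if "degree p < n" for p
  proof -
    \<comment> \<open>The targets have modulus \<open>K\<close> in the direction of the value of
      \<open>p\<close>, or are 0 where that value is 0.\<close>
    define t where "t a = of_real K * sgn (?ev p a)" for a
    define u where "u j = Re (coeff (ip t) j)" for j
    define w where "w = (\<Sum>j<n. monom (round (u j)) j)"
    have w0: "coeff w j = 0" if "j \<ge> n" for j using that by (simp add: w_def coeff_sum_monom)
    have t_cnj: "cnj (t (cnj a)) = t a" for a
      by (simp add: t_def poly_of_int_poly_cnj sgn_eq)
    \<comment> \<open>The targets respect conjugation, so conjugating the coefficients of the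
      interpolant does not change its values at the roots. Averaging both versions shows that the
      real parts alone interpolate.\<close>
    have u_eval: "(\<Sum>j<n. of_real (u j) * a ^ j) = t a" if a: "a \<in> R" for a
    proof -
      have e: "(\<Sum>j<n. coeff (ip t) j * b ^ j) = t b" if "b \<in> R" for b
        using poly_eq_sum_lessThan[of n "ip t" b] ip_coeff0 ip_poly[OF that] by simp
      have "(\<Sum>j<n. cnj (coeff (ip t) j) * a ^ j) = cnj (\<Sum>j<n. coeff (ip t) j * cnj a ^ j)"
        by simp
      also have "\<dots> = t a" using e[OF cnjR[OF a]] t_cnj by simp
      finally have "(\<Sum>j<n. cnj (coeff (ip t) j) * a ^ j) = t a" .
      then have "(\<Sum>j<n. (coeff (ip t) j + cnj (coeff (ip t) j)) * a ^ j) = 2 * t a"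
        using e[OF a] by (simp add: distrib_right sum.distrib)
      moreover have "coeff (ip t) j + cnj (coeff (ip t) j) = 2 * of_real (u j)" for j
        by (simp add: u_def complex_add_cnj)
      ultimately have "2 * (\<Sum>j<n. of_real (u j) * a ^ j) = 2 * t a"
        by (simp add: sum_distrib_left mult.assoc)
      then show ?thesis by simp
    qed
    have w_eval: "cmod (t a - ?ev w a) \<le> 1 * S" if a: "a \<in> R" for a
    proof -
      have "?ev w a = (\<Sum>j<n. of_int (round (u j)) * a ^ j)"
        by (subst poly_eq_sum_lessThan[of n]) (auto simp: w0 w_def coeff_sum_monom)
      then have "t a - ?ev w a = (\<Sum>j<n. (of_real (u j) - of_int (round (u j))) * a ^ j)"
        by (simp add: u_eval[OF a, symmetric] sum_subtractf left_diff_distrib)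
      moreover have "cmod (of_real (u j) - of_int (round (u j))) \<le> 1" for j
      proof -
        have "cmod (of_real (u j) - of_int (round (u j))) = \<bar>u j - of_int (round (u j))\<bar>"
          by (metis norm_of_real of_real_diff of_real_of_int_eq)
        then show ?thesis using of_int_round_abs_le[of "u j"] by linarith
      qed
      ultimately show ?thesis using eval_bound[OF a, of "\<lambda>j. of_real (u j) - of_int (round (u j))" 1]
        by simp
    qed
    \<comment> \<open>The small correction \<open>d\<close> makes \<open>p - w - d\<close> divisible
      by the \<open>n\<close>-th power of the variable modulo \<open>f\<close>; the block of digits
      is \<open>w + d\<close>.\<close>
    obtain d q where dq: "f dvd (p - w) - d - monom 1 n * q" "\<And>j. j \<ge> n \<Longrightarrow> coeff d j = 0"
      "\<And>j. \<bar>coeff d j\<bar> \<le> \<bar>coeff f 0\<bar>" "degree q \<le> max (degree (p - w) - n) (n - 1)"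
      using low_end_division[OF f0, of "p - w" n] by (auto simp: n_def)
    have "degree (p - w) \<le> n"
      using that w0 by (intro degree_le) (auto simp: coeff_eq_0)
    then have degq: "degree q < n" using dq(4) deg by (auto simp: n_def)
    have "\<bar>coeff (w + d) j\<bar> \<le> B" for j
    proof -
      have "cmod (t a) \<le> K" for a using E0 by (simp add: t_def norm_mult norm_sgn K_def)
      then have "\<bar>u j\<bar> \<le> K * C"
        using ip_bound[of t K j] abs_Re_le_cmod[of "coeff (ip t) j"] E0
        by (auto simp: u_def K_def intro: order.trans)
      then have "\<bar>round (u j)\<bar> \<le> \<lceil>K * C\<rceil> + 1"
        using of_int_round_abs_le[of "u j"] by linarith
      then show ?thesis using dq(3)[of j] ceil0
        unfolding B_def w_def coeff_add coeff_sum_monom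
        by (cases "j < n"; simp only: if_True if_False; linarith)
    qed
    moreover have "cmod (?ev q a) \<le> max (2 * E + 1) (cmod (?ev p a) - 1)" if a: "a \<in> R" for a
    proof -
      obtain g where "(p - w) - d - monom 1 n * q = f * g" using dq(1) by (auto simp: dvd_def)
      then have "?ev ((p - w) - d - monom 1 n * q) a = ?ev (f * g) a" by simp
      then have "?ev p a - ?ev w a - ?ev d a - a ^ n * ?ev q a = 0"
        using a by (simp add: R_def hom_distribs poly_monom)
      then have eq: "a ^ n * ?ev q a = (?ev p a - t a) + (t a - ?ev w a) - ?ev d a"
        by (simp add: algebra_simps)
      have "?ev d a = (\<Sum>j<n. of_int (coeff d j) * a ^ j)"
        by (subst poly_eq_sum_lessThan[of n]) (auto simp: dq(2))
      then have "cmod (?ev d a) \<le> \<bar>real_of_int (coeff f 0)\<bar> * S"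
        using eval_bound[OF a, of "\<lambda>j. of_int (coeff d j)" "\<bar>real_of_int (coeff f 0)\<bar>"] dq(3)
        by (simp add: norm_of_int flip: of_int_abs)
      moreover have "cmod (a ^ n * ?ev q a) \<le>
          cmod (?ev p a - t a) + cmod (t a - ?ev w a) + cmod (?ev d a)"
        unfolding eq by (meson norm_triangle_ineq norm_triangle_ineq4 add_right_mono order.trans)
      ultimately have "cmod (a ^ n * ?ev q a) \<le> cmod (?ev p a - t a) + E"
        using w_eval[OF a] by (simp add: E_def distrib_right)
      also have "\<dots> \<le> max (2 * E + 1) (cmod (?ev p a) - 1)"
        unfolding t_def by (rule norm_diff_scaled_sgn_le) (simp_all add: K_def E0)
      finally have le: "cmod (a ^ n * ?ev q a) \<le> max (2 * E + 1) (cmod (?ev p a) - 1)" .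
      \<comment> \<open>Since \<open>a\<close> has modulus at least 1, dividing by
        \<open>a ^ n\<close> does not increase the value.\<close>
      have "1 \<le> cmod a ^ n" using roots[of a] a by (simp add: R_def one_le_power)
      then have "1 * cmod (?ev q a) \<le> cmod a ^ n * cmod (?ev q a)"
        by (rule mult_right_mono) simp
      then show ?thesis using le by (simp add: norm_mult norm_power)
    qed
    ultimately show ?thesis using dq w0 degq
      by (intro exI[of _ "w + d"] exI[of _ q]) (auto simp: algebra_simps)
  qed

  \<comment> \<open>\<open>m\<close> bounds the excess of the values over \<open>2 * E + 1\<close>,
    and each block lowers it by 1. Without excess, interpolation recovers the coefficients from the
    values and bounds them by \<open>B\<close>.\<close>
  have small: "reduces_to_height B f p"
    if "degree p < n" "\<And>a. a \<in> R \<Longrightarrow> cmod (?ev p a) \<le> 2 * E + 1 + real m" for p m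
    using that
  proof (induction m arbitrary: p)
    case 0
    have "\<bar>coeff p j\<bar> \<le> B" for j
    proof -
      have "of_int_poly p = ip (?ev p)" using 0(1) by (intro ip_unique) simp
      then have "cmod (of_int (coeff p j)) \<le> (2 * E + 1) * C"
        using ip_bound[of "?ev p" "2 * E + 1" j] 0(2) E0 by (metis add_nonneg_nonneg add.right_neutral
            coeff_map_poly mult_nonneg_nonneg of_int_0 of_nat_0 zero_le_numeral zero_le_one)
      then have "real_of_int \<bar>coeff p j\<bar> \<le> (2 * E + 1) * C" by (simp add: norm_of_int)
      then have "\<bar>coeff p j\<bar> \<le> \<lceil>(2 * E + 1) * C\<rceil>" by linarith
      then show ?thesis using ceil0 unfolding B_def by linarith
    qed
    then show ?case unfolding reduces_to_height_def by (intro exI[of _ p]) simp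
  next
    case (Suc m)
    obtain d q where dq: "f dvd p - d - monom 1 n * q" "\<And>j. j \<ge> n \<Longrightarrow> coeff d j = 0"
      "\<And>j. \<bar>coeff d j\<bar> \<le> B" "degree q < n"
      "\<And>a. a \<in> R \<Longrightarrow> cmod (?ev q a) \<le> max (2 * E + 1) (cmod (?ev p a) - 1)"
      using step[OF Suc.prems(1)] by blast
    have "cmod (?ev q a) \<le> 2 * E + 1 + real m" if "a \<in> R" for a
      using dq(5)[OF that] Suc.prems(2)[OF that] by auto
    then have "reduces_to_height B f q" using Suc.IH dq(4) by blast
    then show ?case using dq by (intro reduces_to_height_shift[of f p d n q]) auto
  qed

  have "reduces_to_height B f p" for p
  proof -
    \<comment> \<open>Splitting off \<open>degree p\<close> digits first brings an arbitrary
      \<open>p\<close> down to degree below \<open>n\<close>, with no control on the size of the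
      quotient; the excess \<open>m\<close> absorbs that size.\<close>
    obtain d q where dq: "f dvd p - d - monom 1 (degree p) * q"
      "\<And>j. j \<ge> degree p \<Longrightarrow> coeff d j = 0"
      "\<And>j. \<bar>coeff d j\<bar> \<le> \<bar>coeff f 0\<bar>" "degree q \<le> n - 1"
      using low_end_division[OF f0, of p "degree p"] by (auto simp: n_def)
    have B: "\<bar>coeff f 0\<bar> \<le> B" using ceil0 unfolding B_def by linarith
    obtain m where m: "(\<Sum>a\<in>R. cmod (?ev q a)) \<le> real m" using real_arch_simple by blast
    have "cmod (?ev q a) \<le> 2 * E + 1 + real m" if "a \<in> R" for a
    proof -
      have "cmod (?ev q a) \<le> (\<Sum>a\<in>R. cmod (?ev q a))"
        using fin that by (intro member_le_sum) auto
      then show ?thesis using m E0 by linarith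
    qed
    moreover have "degree q < n" using dq(4) deg by (auto simp: n_def)
    ultimately have "reduces_to_height B f q" using small by blast
    then show ?thesis using dq B
      by (intro reduces_to_height_shift[of f p d "degree p" q]) (auto intro: order.trans)
  qed
  then show ?thesis by (auto simp: height_reducing_def)
qed

section \<open>Height-reducing multiples of rational polynomials\<close>

lemma clear_denominators:
  fixes p :: "rat poly"
  shows "\<exists>c q. c \<noteq> 0 \<and> of_int_poly q = Polynomial.smult (of_int c) p"
proof (induction p)
  case 0
  show ?case by (intro exI[of _ 1] exI[of _ 0]) simp
next
  case (pCons a p)
  obtain c q where cq: "c \<noteq> 0" "of_int_poly q = Polynomial.smult (of_int c) p"
    using pCons.IH by blast
  obtain x y where xy: "quotient_of a = (x, y)" by (cases "quotient_of a")
  have "y > 0" using quotient_of_denom_pos[OF xy] .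
  have a: "a = of_int x / of_int y" using quotient_of_div[OF xy] .
  have "of_int_poly (pCons (c * x) (Polynomial.smult y q)) =
      Polynomial.smult (of_int (c * y)) (pCons a p)"
    using \<open>y > 0\<close> by (simp add: a hom_distribs cq(2) mult.commute)
  then show ?case using cq(1) \<open>y > 0\<close> by (metis less_irrefl mult_eq_0_iff)
qed

text \<open>In characteristic 0 such a \<open>p\<close> is coprime to its derivative. The Bezout
  identity over the rationals persists over the complex numbers and excludes a common root.\<close>

lemma irreducible_rat_poly_rsquarefree:
  fixes p :: "rat poly"
  assumes "irreducible p" "degree p > 0"
  shows "rsquarefree (map_poly of_rat p :: complex poly)"
  unfolding rsquarefree_roots
proof (intro allI notI, elim conjE)
  fix z :: complex
  let ?h = "map_poly of_rat :: rat poly \<Rightarrow> complex poly"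
  assume z: "poly (?h p) z = 0" "poly (pderiv (?h p)) z = 0"
  interpret h: map_poly_idom_hom "of_rat :: rat \<Rightarrow> complex" ..
  have "\<not> p dvd pderiv p" using assms(2) by (simp add: not_dvd_pderiv)
  then have "coprime p (pderiv p)"
    using prime_elem_imp_coprime[OF irreducible_imp_prime_elem_gcd[OF assms(1)]] by blast
  then obtain u v where "u * p + v * pderiv p = 1"
    using bezout_coefficients_fst_snd[of p "pderiv p"] by (metis coprime_iff_gcd_eq_1)
  then have "?h (u * p + v * pderiv p) = ?h 1" by simp
  then have "?h u * ?h p + ?h v * pderiv (?h p) = 1"
    by (simp add: of_rat_hom.map_poly_pderiv h.hom_add h.hom_mult)
  then have "poly (?h u * ?h p + ?h v * pderiv (?h p)) z = 1" by simp
  then show False using z by simp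
qed

text \<open>Induction along a factorisation over the rationals: irreducible factors have simple
  roots, and \<open>height_reducing_mult\<close> takes care of repeated factors.\<close>

lemma height_reducing_multiple_exists:
  fixes p :: "rat poly"
  assumes "p \<noteq> 0"
    and "\<And>z :: complex. poly (map_poly of_rat p) z = 0 \<Longrightarrow> cmod z \<ge> 1"
  shows "\<exists>f. height_reducing f \<and> p dvd of_int_poly f"
  using assms
proof (induction "degree p" arbitrary: p rule: less_induct)
  case less
  let ?h = "map_poly of_rat :: rat poly \<Rightarrow> complex poly"
  interpret h: map_poly_idom_hom "of_rat :: rat \<Rightarrow> complex" ..
  obtain c q where cq: "c \<noteq> 0" "of_int_poly q = Polynomial.smult (of_int c) p"
    using clear_denominators by blast
  have dvd: "p dvd of_int_poly q" using cq by (simp add: dvd_smult)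
  have "degree (of_int_poly q :: rat poly) = degree p" using cq by simp
  then have degq: "degree q = degree p" by simp
  have hq: "(of_int_poly q :: complex poly) = Polynomial.smult (of_int c) (?h p)"
  proof -
    have "?h (of_int_poly q) = of_int_poly q"
      by (rule poly_eqI) (simp add: coeff_map_poly)
    then show ?thesis unfolding cq(2) by (simp add: hom_distribs)
  qed
  consider "degree p = 0" | "degree p > 0" "irreducible p" | "degree p > 0" "\<not> irreducible p"
    by blast
  then show ?case
  proof cases
    case 1
    then obtain a where "q = [:a:]" using degq by (metis degree_eq_zeroE)
    moreover have "q \<noteq> 0" using cq less.prems(1) by auto
    ultimately have "height_reducing q" using height_reducing_const by auto
    then show ?thesis using dvd by blast
  next
    case 2
    have "rsquarefree (of_int_poly q :: complex poly)"
      using irreducible_rat_poly_rsquarefree[OF 2(2,1)] cq(1)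
      unfolding hq rsquarefree_roots by (simp add: pderiv_smult)
    moreover have "cmod z \<ge> 1" if "poly (of_int_poly q) z = 0" for z
      using that less.prems(2) cq(1) by (simp add: hq)
    ultimately have "height_reducing q"
      using 2(1) degq by (intro height_reducing_squarefree) auto
    then show ?thesis using dvd by blast
  next
    case 3
    have "\<not> p dvd 1" using 3(1) by (auto simp: is_unit_iff_degree[OF less.prems(1)])
    then obtain a b where ab: "p = a * b" "\<not> a dvd 1" "\<not> b dvd 1"
      using 3(2) less.prems(1) by (auto simp: irreducible_def)
    then have nz: "a \<noteq> 0" "b \<noteq> 0" using less.prems(1) by auto
    have "degree a > 0" "degree b > 0"
      using ab nz is_unit_iff_degree by blast+
    then have "degree a < degree p" "degree b < degree p"
      unfolding ab(1) using nz by (simp_all add: degree_mult_eq)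
    moreover have "cmod z \<ge> 1" if "poly (?h a) z = 0 \<or> poly (?h b) z = 0" for z
      using that less.prems(2)[of z] by (auto simp: ab(1) h.hom_mult)
    ultimately obtain f g where "height_reducing f" "a dvd of_int_poly f"
      "height_reducing g" "b dvd of_int_poly g"
      using less.hyps nz by metis
    then have "height_reducing (f * g)" "p dvd of_int_poly (f * g)"
      by (simp_all add: height_reducing_mult ab(1) hom_distribs mult_dvd_mono)
    then show ?thesis by blast
  qed
qed

section \<open>Polynomials in a matrix\<close>

text \<open>The \<open>(i, k)\<close> entry of p(A), treated as a linear functional of
  \<open>p\<close>, so that no ring of matrices is needed.\<close>

definition matrix_poly_entry :: "'a::comm_ring_1 mat \<Rightarrow> nat \<Rightarrow> nat \<Rightarrow> 'a poly \<Rightarrow> 'a" where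
  "matrix_poly_entry A i k p = (\<Sum>j\<le>degree p. coeff p j * (A ^\<^sub>m j) $$ (i, k))"

lemma matrix_poly_entry_eq_sum:
  assumes "\<And>j. j \<ge> N \<Longrightarrow> coeff p j = 0"
  shows "matrix_poly_entry A i k p = (\<Sum>j<N. coeff p j * (A ^\<^sub>m j) $$ (i, k))"
proof -
  have "matrix_poly_entry A i k p = (\<Sum>j<max N (Suc (degree p)). coeff p j * (A ^\<^sub>m j) $$ (i, k))"
    unfolding matrix_poly_entry_def
    by (intro sum.mono_neutral_left) (auto simp: coeff_eq_0)
  also have "\<dots> = (\<Sum>j<N. coeff p j * (A ^\<^sub>m j) $$ (i, k))"
    using assms by (intro sum.mono_neutral_right) auto
  finally show ?thesis .
qed

lemma matrix_poly_entry_0 [simp]: "matrix_poly_entry A i k 0 = 0"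
  by (simp add: matrix_poly_entry_def)

lemma matrix_poly_entry_add:
  "matrix_poly_entry A i k (p + q) = matrix_poly_entry A i k p + matrix_poly_entry A i k q"
proof -
  let ?N = "Suc (max (degree p) (degree q))"
  have "matrix_poly_entry A i k r = (\<Sum>j<?N. coeff r j * (A ^\<^sub>m j) $$ (i, k))"
    if "r \<in> {p, q, p + q}" for r
    using that by (intro matrix_poly_entry_eq_sum) (auto simp: coeff_eq_0)
  then show ?thesis by (simp add: distrib_right sum.distrib)
qed

lemma matrix_poly_entry_sum:
  "matrix_poly_entry A i k (\<Sum>x\<in>X. p x) = (\<Sum>x\<in>X. matrix_poly_entry A i k (p x))"
  by (induction X rule: infinite_finite_induct) (simp_all add: matrix_poly_entry_add)

lemma matrix_poly_entry_smult:
  "matrix_poly_entry A i k (Polynomial.smult c p) = c * matrix_poly_entry A i k p"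
proof -
  have "matrix_poly_entry A i k (Polynomial.smult c p) =
      (\<Sum>j<Suc (degree p). coeff (Polynomial.smult c p) j * (A ^\<^sub>m j) $$ (i, k))"
    by (intro matrix_poly_entry_eq_sum) (auto simp: coeff_eq_0)
  then show ?thesis
    by (simp add: matrix_poly_entry_def sum_distrib_left mult.assoc lessThan_Suc_atMost)
qed

text \<open>Entry form of (x p)(A) = p(A) A; moving everything to one side gives the annihilation of
  a column of xI - A.\<close>

lemma matrix_poly_entry_shift:
  assumes A: "A \<in> carrier_mat n n" and "i < n" "k < n"
  shows "matrix_poly_entry A i k (pCons 0 p) = (\<Sum>l<n. A $$ (l, k) * matrix_poly_entry A i l p)"
proof -
  have pow: "(A ^\<^sub>m Suc j) $$ (i, k) = (\<Sum>l<n. (A ^\<^sub>m j) $$ (i, l) * A $$ (l, k))" for j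
    using A assms(2,3) pow_carrier_mat[OF A, of j]
    by (auto simp: scalar_prod_def atLeast0LessThan intro!: sum.cong)
  have "matrix_poly_entry A i k (pCons 0 p) =
      (\<Sum>j<Suc (Suc (degree p)). coeff (pCons 0 p) j * (A ^\<^sub>m j) $$ (i, k))"
    by (intro matrix_poly_entry_eq_sum) (auto simp: coeff_pCons coeff_eq_0 split: nat.split)
  also have "\<dots> = (\<Sum>j\<le>degree p. coeff p j * (A ^\<^sub>m Suc j) $$ (i, k))"
    by (subst sum.lessThan_Suc_shift) (simp add: lessThan_Suc_atMost del: sum.lessThan_Suc pow_mat.simps)
  also have "\<dots> = (\<Sum>j\<le>degree p. \<Sum>l<n. A $$ (l, k) * (coeff p j * (A ^\<^sub>m j) $$ (i, l)))"
    unfolding pow sum_distrib_left by (simp add: mult_ac)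
  also have "\<dots> = (\<Sum>l<n. A $$ (l, k) * matrix_poly_entry A i l p)"
    unfolding matrix_poly_entry_def sum_distrib_left by (rule sum.swap)
  finally show ?thesis .
qed

text \<open>Cayley--Hamilton, one entry at a time. The functionals \<open>matrix_poly_entry A i\<close> annihilate
  the columns of the characteristic matrix \<open>xI - A\<close>, hence also its product with its adjugate.\<close>

lemma matrix_poly_entry_char_poly_mult:
  assumes A: "A \<in> carrier_mat n n" and i: "i < n" and m: "m < n"
  shows "matrix_poly_entry A i m (char_poly A * q) = 0"
proof -
  let ?E = "matrix_poly_entry A i"
  let ?X = "char_poly_matrix A" and ?Y = "adj_mat (char_poly_matrix A)"
  have X: "?X \<in> carrier_mat n n" using A by simp
  have Y: "?Y \<in> carrier_mat n n" and XY: "?X * ?Y = char_poly A \<cdot>\<^sub>m 1\<^sub>m n"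
    using adj_mat[OF X] by (auto simp: char_poly_def)
  have col: "(\<Sum>l<n. ?E l (?X $$ (l, k) * p)) = 0" if k: "k < n" for k p
  proof -
    have "?E l (?X $$ (l, k) * p) = (if l = k then ?E k (pCons 0 p) else 0) - A $$ (l, k) * ?E l p"
      if "l < n" for l
    proof -
      have "?X $$ (l, k) * p = (if l = k then pCons 0 p else 0) + Polynomial.smult (- A $$ (l, k)) p"
        using A k that by (simp add: char_poly_matrix_def)
      then show ?thesis by (simp add: matrix_poly_entry_add matrix_poly_entry_smult
            del: smult_minus_left)
    qed
    then have "(\<Sum>l<n. ?E l (?X $$ (l, k) * p)) =
        (\<Sum>l<n. if l = k then ?E k (pCons 0 p) else 0) - (\<Sum>l<n. A $$ (l, k) * ?E l p)"
      by (simp add: sum_subtractf)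
    then show ?thesis using k by (simp add: matrix_poly_entry_shift[OF A i k])
  qed
  \<comment> \<open>With \<open>p\<close> running through column \<open>m\<close> of the adjugate
    times \<open>q\<close>, swapping the sums assembles the product of the characteristic matrix
    with its adjugate, which is diagonal.\<close>
  have "0 = (\<Sum>k<n. \<Sum>l<n. ?E l (?X $$ (l, k) * (?Y $$ (k, m) * q)))"
    using col by simp
  also have "\<dots> = (\<Sum>l<n. ?E l (\<Sum>k<n. ?X $$ (l, k) * (?Y $$ (k, m) * q)))"
    by (subst sum.swap) (simp add: matrix_poly_entry_sum)
  also have "\<dots> = (\<Sum>l<n. ?E l ((?X * ?Y) $$ (l, m) * q))"
  proof (intro sum.cong refl)
    fix l assume "l \<in> {..<n}"
    then have "(?X * ?Y) $$ (l, m) = (\<Sum>k<n. ?X $$ (l, k) * ?Y $$ (k, m))"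
      using X Y m by (auto simp: scalar_prod_def atLeast0LessThan intro!: sum.cong)
    then show "?E l (\<Sum>k<n. ?X $$ (l, k) * (?Y $$ (k, m) * q)) = ?E l ((?X * ?Y) $$ (l, m) * q)"
      by (simp add: sum_distrib_right mult.assoc)
  qed
  also have "\<dots> = (\<Sum>l<n. if l = m then ?E m (char_poly A * q) else 0)"
    unfolding XY using m by (intro sum.cong) auto
  also have "\<dots> = ?E m (char_poly A * q)" using m by simp
  finally show ?thesis by simp
qed

section \<open>Digit expansions\<close>

lemma matrix_power_sum_carrier:
  assumes "A \<in> carrier_mat n n" "\<And>j. j \<in> J \<Longrightarrow> v j \<in> carrier_vec n"
  shows "matrix_power_sum n A v J \<in> carrier_vec n"
  unfolding matrix_power_sum_def using assms
  by (intro finsum_vec_closed) (auto intro!: mult_mat_vec_carrier pow_carrier_mat)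

lemma index_matrix_power_sum:
  assumes A: "A \<in> carrier_mat n n" and v: "\<And>j. j \<in> J \<Longrightarrow> v j \<in> carrier_vec n"
    and J: "finite J" and i: "i < n"
  shows "matrix_power_sum n A v J $ i = (\<Sum>j\<in>J. \<Sum>k<n. (A ^\<^sub>m j) $$ (i, k) * v j $ k)"
proof -
  have "matrix_power_sum n A v J $ i = (\<Sum>j\<in>J. ((A ^\<^sub>m j) *\<^sub>v v j) $ i)"
    unfolding matrix_power_sum_def using assms
    by (intro index_finsum_vec) (auto intro!: mult_mat_vec_carrier pow_carrier_mat)
  also have "\<dots> = (\<Sum>j\<in>J. \<Sum>k<n. (A ^\<^sub>m j) $$ (i, k) * v j $ k)"
  proof (intro sum.cong refl)
    fix j assume "j \<in> J"
    then show "((A ^\<^sub>m j) *\<^sub>v v j) $ i = (\<Sum>k<n. (A ^\<^sub>m j) $$ (i, k) * v j $ k)"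
      using v[of j] A pow_carrier_mat[OF A, of j] i
      by (auto simp: scalar_prod_def atLeast0LessThan intro!: sum.cong)
  qed
  finally show ?thesis .
qed

lemma int_vecs_carrier: "v \<in> int_vecs n \<Longrightarrow> v \<in> carrier_vec n"
  by (simp add: int_vecs_def)

lemma int_module_carrier:
  assumes "A \<in> carrier_mat n n"
  shows "int_module n A \<subseteq> carrier_vec n"
proof
  fix z assume "z \<in> int_module n A"
  then obtain k v where "z = matrix_power_sum n A v {..<k}" "\<forall>j<k. v j \<in> int_vecs n"
    by (auto simp: int_module_def)
  then show "z \<in> carrier_vec n"
    using matrix_power_sum_carrier[OF assms, of "{..<k}" v] by (simp add: int_vecs_carrier)
qed

lemma int_vecs_subset_int_module:
  assumes "A \<in> carrier_mat n n"
  shows "int_vecs n \<subseteq> int_module n A"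
proof
  fix v assume v: "v \<in> int_vecs n"
  have "matrix_power_sum n A (\<lambda>_. v) {..<1} = v"
  proof (rule eq_vecI)
    fix i assume "i < dim_vec v"
    then have i: "i < n" using int_vecs_carrier[OF v] by simp
    have "matrix_power_sum n A (\<lambda>_. v) {..<1} $ i = (\<Sum>k<n. 1\<^sub>m n $$ (i, k) * v $ k)"
      using assms i int_vecs_carrier[OF v] by (subst index_matrix_power_sum) auto
    also have "\<dots> = (\<Sum>k<n. if i = k then v $ k else 0)"
      using i by (intro sum.cong) auto
    also have "\<dots> = v $ i" using i by simp
    finally show "matrix_power_sum n A (\<lambda>_. v) {..<1} $ i = v $ i" .
  next
    show "dim_vec (matrix_power_sum n A (\<lambda>_. v) {..<1}) = dim_vec v"
      using matrix_power_sum_carrier[OF assms, of "{..<1}" "\<lambda>_. v"] int_vecs_carrier[OF v] by simp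
  qed
  then show "v \<in> int_module n A"
    unfolding int_module_def using v by (intro UN_I[of 1] CollectI exI[of _ "\<lambda>_. v"]) auto
qed

section \<open>Sufficiency: digits from height reduction\<close>

lemma finiteness_property_if_height_reducing:
  assumes A: "A \<in> carrier_mat n n"
    and f: "height_reducing f" "char_poly A dvd of_int_poly f"
  shows "\<exists>D. D \<subseteq> int_vecs n \<and> digit_system n A D \<and> finiteness_property n A D"
proof -
  obtain B where B: "\<And>p. reduces_to_height B f p" using f(1) by (auto simp: height_reducing_def)
  define D where "D = {v \<in> carrier_vec n. \<forall>i<n. v $ i \<in> (of_int ` {-B..B} :: rat set)}"
  have DZ: "D \<subseteq> int_vecs n" by (auto simp: D_def int_vecs_def)
  have "D \<subseteq> vec n ` ({..<n} \<rightarrow>\<^sub>E (of_int ` {-B..B}))"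
  proof
    fix v assume "v \<in> D"
    then have "v = vec n (restrict (($) v) {..<n})"
      "restrict (($) v) {..<n} \<in> {..<n} \<rightarrow>\<^sub>E (of_int ` {-B..B})"
      by (auto simp: D_def)
    then show "v \<in> vec n ` ({..<n} \<rightarrow>\<^sub>E (of_int ` {-B..B}))" by blast
  qed
  then have finD: "finite D"
    by (rule finite_subset) (auto intro!: finite_imageI finite_PiE)
  have ds: "digit_system n A D"
    using finD DZ int_vecs_subset_int_module[OF A] by (auto simp: digit_system_def)
  have "digit_expansions n A D \<subseteq> int_module n A"
  proof
    fix z assume "z \<in> digit_expansions n A D"
    \<comment> \<open>An expansion with top index \<open>k\<close> has \<open>k + 1\<close> terms,
      whereas the module counts terms.\<close>
    then obtain k d where "z = matrix_power_sum n A d {..<Suc k}" "\<forall>j<Suc k. d j \<in> D"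
      by (auto simp: digit_expansions_def lessThan_Suc_atMost less_Suc_eq_le)
    then show "z \<in> int_module n A"
      unfolding int_module_def using DZ by (intro UN_I[of "Suc k"] CollectI exI[of _ d]) auto
  qed
  moreover have "int_module n A \<subseteq> digit_expansions n A D"
  proof
    fix z assume "z \<in> int_module n A"
    then obtain k v where z: "z = matrix_power_sum n A v {..<k}" and v: "\<And>j. j < k \<Longrightarrow> v j \<in> int_vecs n"
      by (auto simp: int_module_def)
    \<comment> \<open>One polynomial per coordinate, its coefficients being that coordinate of the
      successive vectors; the floor merely turns integral rationals into integers.\<close>
    define p where "p m = (\<Sum>j<k. monom \<lfloor>v j $ m\<rfloor> j)" for m
    have "\<exists>h. \<forall>m. f dvd p m - h m \<and> (\<forall>j. \<bar>coeff (h m) j\<bar> \<le> B)"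
      using B unfolding reduces_to_height_def by (intro choice allI)
    then obtain h where h: "\<And>m. f dvd p m - h m" "\<And>m j. \<bar>coeff (h m) j\<bar> \<le> B" by blast
    \<comment> \<open>A common length for all coordinates: coefficients beyond a degree are 0, which
      still lies in the box.\<close>
    define N where "N = (\<Sum>m<n. degree (h m))"
    define d where "d j = vec n (\<lambda>m. of_int (coeff (h m) j) :: rat)" for j
    have dD: "d j \<in> D" for j
      using h(2) by (auto simp: D_def d_def abs_le_iff intro!: imageI) (metis minus_le_iff)
    have vc: "v j \<in> carrier_vec n" if "j \<in> {..<k}" for j
      using v that by (simp add: int_vecs_carrier)
    have dc: "d j \<in> carrier_vec n" if "j \<in> {..N}" for j by (simp add: d_def)
    have "z = matrix_power_sum n A d {..N}"
    proof (rule eq_vecI)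
      fix i assume "i < dim_vec (matrix_power_sum n A d {..N})"
      then have i: "i < n"
        using matrix_power_sum_carrier[OF A, of "{..N}" d] dc by simp
      let ?E = "\<lambda>m q. matrix_poly_entry A i m (of_int_poly q)"
      \<comment> \<open>Congruence modulo \<open>f\<close> becomes equality of entries, because the
        characteristic polynomial divides \<open>f\<close>.\<close>
      have e1: "?E m (p m) = ?E m (h m)" if "m < n" for m
      proof -
        obtain g where "p m - h m = f * g" using h(1) by (auto simp: dvd_def)
        then have "p m = h m + f * g" by (simp add: algebra_simps)
        moreover obtain r where "of_int_poly f = char_poly A * r" using f(2) by (auto simp: dvd_def)
        ultimately have "of_int_poly (p m) = of_int_poly (h m) + char_poly A * (r * of_int_poly g)"
          by (simp add: hom_distribs mult.assoc)
        then show ?thesis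
          by (simp add: matrix_poly_entry_add matrix_poly_entry_char_poly_mult[OF A i that])
      qed
      have e2: "?E m (p m) = (\<Sum>j<k. (A ^\<^sub>m j) $$ (i, m) * v j $ m)" if "m < n" for m
      proof -
        have "?E m (p m) = (\<Sum>j<k. of_int (coeff (p m) j) * (A ^\<^sub>m j) $$ (i, m))"
          by (subst matrix_poly_entry_eq_sum[of k]) (auto simp: p_def coeff_sum_monom)
        also have "\<dots> = (\<Sum>j<k. (A ^\<^sub>m j) $$ (i, m) * v j $ m)"
          using v that by (intro sum.cong) (auto simp: p_def coeff_sum_monom int_vecs_def)
        finally show ?thesis .
      qed
      have e3: "?E m (h m) = (\<Sum>j\<le>N. (A ^\<^sub>m j) $$ (i, m) * d j $ m)" if "m < n" for m
      proof -
        have "degree (h m) \<le> N"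
          unfolding N_def using that by (intro member_le_sum) auto
        then have "?E m (h m) = (\<Sum>j<Suc N. of_int (coeff (h m) j) * (A ^\<^sub>m j) $$ (i, m))"
          by (subst matrix_poly_entry_eq_sum[of "Suc N"]) (auto simp: coeff_eq_0)
        then show ?thesis using that by (simp add: d_def mult.commute lessThan_Suc_atMost)
      qed
      have "(\<Sum>j<k. (A ^\<^sub>m j) $$ (i, m) * v j $ m) = (\<Sum>j\<le>N. (A ^\<^sub>m j) $$ (i, m) * d j $ m)"
        if "m < n" for m
        using e1[OF that] e2[OF that] e3[OF that] by (simp only:)
      then have "(\<Sum>m<n. \<Sum>j<k. (A ^\<^sub>m j) $$ (i, m) * v j $ m) =
          (\<Sum>m<n. \<Sum>j\<le>N. (A ^\<^sub>m j) $$ (i, m) * d j $ m)"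
        by (intro sum.cong[where A = "{..<n}"]) simp_all
      then have "(\<Sum>j<k. \<Sum>m<n. (A ^\<^sub>m j) $$ (i, m) * v j $ m) =
          (\<Sum>j\<le>N. \<Sum>m<n. (A ^\<^sub>m j) $$ (i, m) * d j $ m)"
        by (simp only: sum.swap[of _ "{..<k}" "{..<n}"] sum.swap[of _ "{..N}" "{..<n}"])
      moreover have "z $ i = (\<Sum>j<k. \<Sum>m<n. (A ^\<^sub>m j) $$ (i, m) * v j $ m)"
        unfolding z using vc i by (intro index_matrix_power_sum[OF A]) auto
      moreover have "matrix_power_sum n A d {..N} $ i =
          (\<Sum>j\<le>N. \<Sum>m<n. (A ^\<^sub>m j) $$ (i, m) * d j $ m)"
        using dc i by (intro index_matrix_power_sum[OF A]) auto
      ultimately show "z $ i = matrix_power_sum n A d {..N} $ i" by (simp only:)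
    next
      show "dim_vec z = dim_vec (matrix_power_sum n A d {..N})"
        using matrix_power_sum_carrier[OF A, of "{..N}" d] dc
          matrix_power_sum_carrier[OF A, of "{..<k}" v] vc
        by (simp add: z)
    qed
    then show "z \<in> digit_expansions n A D" using dD by (auto simp: digit_expansions_def)
  qed
  ultimately show ?thesis using DZ ds by (auto simp: finiteness_property_def)
qed

section \<open>Necessity: left eigenvectors for eigenvalues inside the unit disc\<close>

lemma sum_power_left_eigenvector:
  fixes w :: "nat \<Rightarrow> complex"
  assumes A: "A \<in> carrier_mat n n"
    and w: "\<And>k. k < n \<Longrightarrow> (\<Sum>i<n. w i * of_rat (A $$ (i, k))) = l * w k"
    and k: "k < n"
  shows "(\<Sum>i<n. w i * of_rat ((A ^\<^sub>m j) $$ (i, k))) = l ^ j * w k"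
  using k
proof (induction j arbitrary: k)
  case 0
  then have "(\<Sum>i<n. w i * of_rat ((A ^\<^sub>m 0) $$ (i, k))) = (\<Sum>i<n. if i = k then w i else 0)"
    using A by (intro sum.cong) auto
  then show ?case using 0 by simp
next
  case (Suc j)
  have "(\<Sum>i<n. w i * of_rat ((A ^\<^sub>m Suc j) $$ (i, k))) =
      (\<Sum>i<n. \<Sum>m<n. w i * of_rat ((A ^\<^sub>m j) $$ (i, m)) * of_rat (A $$ (m, k)))"
  proof (intro sum.cong refl)
    fix i assume "i \<in> {..<n}"
    then have "(A ^\<^sub>m Suc j) $$ (i, k) = (\<Sum>m<n. (A ^\<^sub>m j) $$ (i, m) * A $$ (m, k))"
      using A Suc.prems pow_carrier_mat[OF A, of j]
      by (auto simp: scalar_prod_def atLeast0LessThan intro!: sum.cong)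
    then show "w i * of_rat ((A ^\<^sub>m Suc j) $$ (i, k)) =
        (\<Sum>m<n. w i * of_rat ((A ^\<^sub>m j) $$ (i, m)) * of_rat (A $$ (m, k)))"
      by (simp add: of_rat_sum of_rat_mult sum_distrib_left mult.assoc)
  qed
  also have "\<dots> = (\<Sum>m<n. (\<Sum>i<n. w i * of_rat ((A ^\<^sub>m j) $$ (i, m))) * of_rat (A $$ (m, k)))"
    by (subst sum.swap) (simp add: sum_distrib_right)
  also have "\<dots> = (\<Sum>m<n. l ^ j * (w m * of_rat (A $$ (m, k))))"
    using Suc.IH by (intro sum.cong) (auto simp: mult.assoc)
  also have "\<dots> = l ^ Suc j * w k"
    by (simp only: sum_distrib_left[symmetric] w[OF Suc.prems]) simp
  finally show ?case .
qed

text \<open>A left eigenvector for \<open>l\<close> is a functional that is bounded on all digit expansions,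
  by a geometric series, but unbounded on the integer vectors.\<close>

lemma not_finiteness_property_if_small_eigenvalue:
  assumes A: "A \<in> carrier_mat n n"
    and ev: "eigenvalue (map_mat of_rat A :: complex mat) l" and l: "cmod l < 1"
    and D: "finite D" "D \<subseteq> int_module n A"
  shows "\<not> finiteness_property n A D"
proof
  assume fp: "finiteness_property n A D"
  let ?A = "map_mat of_rat A :: complex mat"
  have A': "?A \<in> carrier_mat n n" using A by simp
  \<comment> \<open>A matrix and its transpose share their characteristic polynomial, which yields a
    left eigenvector.\<close>
  have "eigenvalue (transpose_mat ?A) l"
    using ev A' by (simp add: eigenvalue_root_char_poly[of _ n])
  then obtain u where u: "u \<in> carrier_vec n" "u \<noteq> 0\<^sub>v n" "transpose_mat ?A *\<^sub>v u = l \<cdot>\<^sub>v u"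
    using A by (auto simp: eigenvalue_def eigenvector_def)
  define w where "w i = u $ i" for i
  have w: "(\<Sum>i<n. w i * of_rat (A $$ (i, k))) = l * w k" if k: "k < n" for k
  proof -
    have "(transpose_mat ?A *\<^sub>v u) $ k = (\<Sum>i<n. w i * of_rat (A $$ (i, k)))"
      using A u(1) k by (auto simp: scalar_prod_def atLeast0LessThan w_def mult.commute intro!: sum.cong)
    then show ?thesis using u k by (simp add: w_def)
  qed
  define \<phi> where "\<phi> z = (\<Sum>i<n. w i * of_rat (z $ i))" for z :: "rat vec"
  have Dc: "d \<in> carrier_vec n" if "d \<in> D" for d
    using D(2) that int_module_carrier[OF A] by blast
  define M where "M = (\<Sum>d\<in>D. cmod (\<phi> d))"
  have M: "cmod (\<phi> d) \<le> M" if "d \<in> D" for d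
    unfolding M_def using that D(1) by (intro member_le_sum) auto
  have M0: "M \<ge> 0" unfolding M_def by (intro sum_nonneg) auto
  have bound: "cmod (\<phi> z) \<le> M / (1 - cmod l)" if "z \<in> int_module n A" for z
  proof -
    have "z \<in> digit_expansions n A D" using fp that by (simp add: finiteness_property_def)
    then obtain k d where z: "z = matrix_power_sum n A d {..k}" and d: "\<And>j. j \<le> k \<Longrightarrow> d j \<in> D"
      by (auto simp: digit_expansions_def)
    have "\<phi> z = (\<Sum>i<n. \<Sum>j\<le>k. \<Sum>m<n. w i * of_rat ((A ^\<^sub>m j) $$ (i, m)) * of_rat (d j $ m))"
      unfolding \<phi>_def z
    proof (intro sum.cong refl)
      fix i assume "i \<in> {..<n}"
      then have "matrix_power_sum n A d {..k} $ i = (\<Sum>j\<le>k. \<Sum>m<n. (A ^\<^sub>m j) $$ (i, m) * d j $ m)"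
        using d Dc by (intro index_matrix_power_sum[OF A]) auto
      then show "w i * of_rat (matrix_power_sum n A d {..k} $ i) =
          (\<Sum>j\<le>k. \<Sum>m<n. w i * of_rat ((A ^\<^sub>m j) $$ (i, m)) * of_rat (d j $ m))"
        by (simp add: of_rat_sum of_rat_mult sum_distrib_left mult.assoc)
    qed
    \<comment> \<open>Summing over \<open>i\<close> innermost lets the left eigenvector absorb the
      \<open>j\<close>-th power of \<open>A\<close> as the factor \<open>l ^ j\<close>.\<close>
    also have "\<dots> = (\<Sum>j\<le>k. \<Sum>m<n. \<Sum>i<n. w i * of_rat ((A ^\<^sub>m j) $$ (i, m)) * of_rat (d j $ m))"
      by (subst sum.swap) (intro sum.cong refl sum.swap)
    also have "\<dots> = (\<Sum>j\<le>k. l ^ j * \<phi> (d j))"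
    proof (intro sum.cong refl)
      fix j
      have "(\<Sum>i<n. w i * of_rat ((A ^\<^sub>m j) $$ (i, m)) * of_rat (d j $ m)) =
          l ^ j * (w m * of_rat (d j $ m))" if "m < n" for m
        using sum_power_left_eigenvector[OF A w that, of j]
        by (simp add: sum_distrib_right[symmetric] mult.assoc[symmetric])
      then show "(\<Sum>m<n. \<Sum>i<n. w i * of_rat ((A ^\<^sub>m j) $$ (i, m)) * of_rat (d j $ m)) =
          l ^ j * \<phi> (d j)"
        by (simp add: \<phi>_def sum_distrib_left)
    qed
    finally have "cmod (\<phi> z) \<le> (\<Sum>j\<le>k. cmod (l ^ j * \<phi> (d j)))" by (simp add: norm_sum)
    also have "\<dots> \<le> (\<Sum>j\<le>k. cmod l ^ j * M)"
      using d M by (intro sum_mono) (auto simp: norm_mult norm_power intro!: mult_left_mono)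
    also have "\<dots> = (\<Sum>j<Suc k. cmod l ^ j) * M"
      by (simp add: sum_distrib_right lessThan_Suc_atMost)
    also have "\<dots> \<le> (1 / (1 - cmod l)) * M"
    proof (rule mult_right_mono[OF _ M0])
      have "(\<Sum>j<Suc k. cmod l ^ j) \<le> (\<Sum>j. cmod l ^ j)"
        using l by (intro sum_le_suminf) auto
      also have "\<dots> = 1 / (1 - cmod l)" using l by (intro suminf_geometric) simp
      finally show "(\<Sum>j<Suc k. cmod l ^ j) \<le> 1 / (1 - cmod l)" .
    qed
    finally show ?thesis by simp
  qed
  \<comment> \<open>Large integer multiples of the unit vector at a nonzero coordinate of the
    eigenvector violate the bound.\<close>
  obtain a where a: "a < n" "w a \<noteq> 0"
    using u(1,2) unfolding w_def by (metis carrier_vecD eq_vecI index_zero_vec)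
  obtain N :: nat where N: "M / (1 - cmod l) < real N * cmod (w a)"
    using ex_less_of_nat_mult[of "cmod (w a)"] a by auto
  let ?z = "vec n (\<lambda>i. if i = a then of_nat N else 0) :: rat vec"
  have "?z \<in> int_vecs n" by (auto simp: int_vecs_def)
  then have "cmod (\<phi> ?z) \<le> M / (1 - cmod l)"
    using bound int_vecs_subset_int_module[OF A] by blast
  moreover have "\<phi> ?z = (\<Sum>i<n. if i = a then w a * of_nat N else 0)"
    unfolding \<phi>_def by (intro sum.cong) auto
  then have "\<phi> ?z = w a * of_nat N" using a by simp
  ultimately show False using N by (simp add: norm_mult mult.commute)
qed

theorem theorem1:
  fixes n :: nat and A :: "rat mat"
  assumes "n \<ge> 1" and "A \<in> carrier_mat n n"
  shows "((\<exists>D. digit_system n A D \<and> finiteness_property n A D) \<longleftrightarrow>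
            \<not> (\<exists>l::complex. eigenvalue (map_mat of_rat A) l \<and> cmod l < 1))
       \<and> (\<not> (\<exists>l::complex. eigenvalue (map_mat of_rat A) l \<and> cmod l < 1) \<longrightarrow>
            (\<exists>D. D \<subseteq> int_vecs n \<and> digit_system n A D \<and> finiteness_property n A D))"
proof -
  \<comment> \<open>The digit set built here is already integral, so it serves both the equivalence
    and the final claim.\<close>
  have "\<exists>D. D \<subseteq> int_vecs n \<and> digit_system n A D \<and> finiteness_property n A D"
    if large: "\<not> (\<exists>l::complex. eigenvalue (map_mat of_rat A) l \<and> cmod l < 1)"
  proof -
    have "char_poly (map_mat of_rat A :: complex mat) = map_poly of_rat (char_poly A)"
      using of_rat_hom.char_poly_hom[OF assms(2)] by simp
    then have "cmod z \<ge> 1" if "poly (map_poly of_rat (char_poly A)) z = 0" for z :: complex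
      using large that assms(2) eigenvalue_root_char_poly[of "map_mat of_rat A" n z]
      by (auto simp: not_less)
    moreover have "char_poly A \<noteq> 0"
      using degree_monic_char_poly[OF assms(2)] by auto
    ultimately obtain f where "height_reducing f" "char_poly A dvd of_int_poly f"
      using height_reducing_multiple_exists by blast
    then show ?thesis by (rule finiteness_property_if_height_reducing[OF assms(2)])
  qed
  moreover have "\<not> (\<exists>l::complex. eigenvalue (map_mat of_rat A) l \<and> cmod l < 1)"
    if "digit_system n A D" "finiteness_property n A D" for D
    using that not_finiteness_property_if_small_eigenvalue[OF assms(2)]
    by (auto simp: digit_system_def)
  ultimately show ?thesis by blast
qed

end
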